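(* For any infinite Hausdorff space $X$ and any ideal $\mathcal A$ of compact subsets of $X$, \[hL_{\mathcal A}(X) \leq dc(\mathrm{PR}_{\mathcal A}(X)).\]
   Context: An ideal of compact subsets of $X$ is a collection $\mathcal A$ of compact subsets of $X$ such that $A\cup B\in\mathcal A$ whenever $A,B\in\mathcal A$ and $\{x\}\in\mathcal A$ for every $x\in X$ (so $\mathcal A$ covers $X$). $\mathrm{PR}_{\mathcal A}(X)$ is the set $\mathcal A$ with the topology having as basis the sets $[A,U]=\{B\in\mathcal A:A\subseteq B\subseteq U\}$, where $A\in\mathcal A$ and $U\subseteq X$ is open. For an open subspace $V\subseteq X$, an $\mathcal A$-cover of $V$ is an open cover $\mathscr U$ of $V$ by open subsets of $V$ with $V\notin\mathscr U$ such that every $A\in\mathcal A$ with $A\subseteq V$ is contained in some $U\in\mathscr U$. The $\mathcal A$-Lindelöf degree $L_{\mathcal A}(V)$ is the least cardinal $\kappa$ such that every $\mathcal A$-cover of $V$ has a subset of size at most $\kappa$ which is an $\mathcal A$-cover of $V$. The hereditary $\mathcal A$-Lindelöf degree $hL_{\mathcal A}(X)$ is the supremum of $L_{\mathcal A}(V)$ over all open subspaces $V$ of $X$. A collection $\mathscr F$ of subsets of a space $Y$ is discrete if every $y\in Y$ has an open neighborhood meeting at most one element of $\mathscr F$. The discrete cellularity $dc(Y)$ is the supremum of all cardinals $\kappa$ for which there is a discrete family of size $\kappa$ consisting of non-empty open subsets of $Y$. *)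

theory Defs
  imports "HOL-Analysis.Analysis"
begin

unbundle cardinal_syntax

section \<open>Least cardinals and suprema of cardinals\<close>

text \<open>
  Cardinals are relations \<open>r\<close> with \<open>Card_order r\<close>, compared by \<open>\<le>o\<close>; finite cardinals are
  included. A least cardinal is only determined up to \<open>=o\<close>, hence the choice operator.
  The definition quantifies over the cardinals representable on the type \<open>'c\<close>, but these are an
  initial segment of all cardinals, so \<open>least_cardinal_le\<close> and \<open>card_Sup_le\<close> below hold against
  cardinals on an arbitrary type.
\<close>

definition least_cardinal :: "('c rel \<Rightarrow> bool) \<Rightarrow> 'c rel" where
  "least_cardinal P =
     (SOME \<kappa>. Card_order \<kappa> \<and> P \<kappa> \<and> (\<forall>\<mu>. Card_order \<mu> \<and> P \<mu> \<longrightarrow> \<kappa> \<le>o \<mu>))"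

definition card_Sup :: "'c rel set \<Rightarrow> 'c rel" where
  "card_Sup S = least_cardinal (\<lambda>\<kappa>. \<forall>\<mu>\<in>S. \<mu> \<le>o \<kappa>)"

lemma least_cardinal:
  fixes P :: "'c rel \<Rightarrow> bool"
  assumes "Card_order \<nu>" "P \<nu>"
  shows "Card_order (least_cardinal P)" "P (least_cardinal P)"
    and "\<And>\<mu>. Card_order \<mu> \<Longrightarrow> P \<mu> \<Longrightarrow> least_cardinal P \<le>o \<mu>"
proof -
  have "\<exists>\<kappa>\<in>{\<kappa>. Card_order \<kappa> \<and> P \<kappa>}. \<forall>\<mu>\<in>{\<kappa>. Card_order \<kappa> \<and> P \<kappa>}. \<kappa> \<le>o \<mu>"
    using assms by (intro exists_minim_Card_order) auto
  then have "\<exists>\<kappa>. Card_order \<kappa> \<and> P \<kappa> \<and> (\<forall>\<mu>. Card_order \<mu> \<and> P \<mu> \<longrightarrow> \<kappa> \<le>o \<mu>)"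
    by blast
  from someI_ex[OF this]
  show "Card_order (least_cardinal P)" "P (least_cardinal P)"
    "\<And>\<mu>. Card_order \<mu> \<Longrightarrow> P \<mu> \<Longrightarrow> least_cardinal P \<le>o \<mu>"
    unfolding least_cardinal_def by blast+
qed

lemma least_cardinal_le:
  fixes P :: "'c rel \<Rightarrow> bool" and \<mu> :: "'d rel"
  assumes "Card_order \<nu>" "P \<nu>" "Card_order \<mu>"
    and "\<And>\<kappa>. Card_order \<kappa> \<Longrightarrow> \<kappa> =o \<mu> \<Longrightarrow> P \<kappa>"
  shows "least_cardinal P \<le>o \<mu>"
proof (rule ccontr)
  note lc = least_cardinal[of \<nu> P, OF assms(1,2)]
  assume "\<not> ?thesis"
  then have less: "\<mu> <o least_cardinal P"
    using not_ordLeq_iff_ordLess[of \<mu> "least_cardinal P"] lc(1) assms(3) unfolding card_order_on_def by blast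
  then obtain p :: "'c rel" where p: "\<mu> =o p"
    using internalize_ordLess[of \<mu> "least_cardinal P"] by blast
  have "|Field \<mu>| =o \<mu>" using assms(3) by (rule card_of_Field_ordIso)
  then have "p =o |Field \<mu>|"
    using p ordIso_symmetric ordIso_transitive by metis
  then have "Card_order p" by (rule ordIso_card_of_imp_Card_order)
  then have "least_cardinal P \<le>o p"
    using lc(3) assms(4) p ordIso_symmetric by blast
  then have "least_cardinal P \<le>o \<mu>"
    using p ordIso_symmetric ordLeq_ordIso_trans by blast
  then show False using less not_ordLess_ordLeq by blast
qed

lemma Card_order_le_UNIV:
  fixes \<mu> :: "'c rel"
  assumes "Card_order \<mu>"
  shows "\<mu> \<le>o |UNIV :: 'c set|"
  using assms card_of_mono1[OF subset_UNIV, of "Field \<mu>"] unfolding Card_order_iff_ordLeq_card_of by (rule ordLeq_transitive)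

lemma card_Sup:
  fixes S :: "'c rel set"
  assumes "\<And>\<mu>. \<mu> \<in> S \<Longrightarrow> Card_order \<mu>"
  shows Card_order_card_Sup: "Card_order (card_Sup S)"
    and card_Sup_upper: "\<And>\<mu>. \<mu> \<in> S \<Longrightarrow> \<mu> \<le>o card_Sup S"
proof -
  have "\<forall>\<mu>\<in>S. \<mu> \<le>o |UNIV :: 'c set|" using assms Card_order_le_UNIV by blast
  from least_cardinal[of "|UNIV :: 'c set|" "\<lambda>\<kappa>. \<forall>\<mu>\<in>S. \<mu> \<le>o \<kappa>", OF card_of_Card_order this]
  show "Card_order (card_Sup S)" "\<And>\<mu>. \<mu> \<in> S \<Longrightarrow> \<mu> \<le>o card_Sup S"
    unfolding card_Sup_def by blast+
qed

lemma card_Sup_le: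
  fixes S :: "'c rel set" and \<kappa> :: "'d rel"
  assumes "\<And>\<mu>. \<mu> \<in> S \<Longrightarrow> Card_order \<mu>" "Card_order \<kappa>" "\<And>\<mu>. \<mu> \<in> S \<Longrightarrow> \<mu> \<le>o \<kappa>"
  shows "card_Sup S \<le>o \<kappa>"
  unfolding card_Sup_def
proof (rule least_cardinal_le)
  show "Card_order |UNIV :: 'c set|" by (rule card_of_Card_order)
  show "\<forall>\<mu>\<in>S. \<mu> \<le>o |UNIV :: 'c set|" using assms(1) Card_order_le_UNIV by blast
  show "\<forall>\<mu>\<in>S. \<mu> \<le>o \<kappa>'" if "\<kappa>' =o \<kappa>" for \<kappa>' :: "'c rel"
    using assms(3) that ordIso_symmetric ordLeq_ordIso_trans by blast
qed fact

section \<open>Ideals of compact sets and the space \<open>PR\<^sub>A(X)\<close>\<close>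

definition compact_ideal :: "'a topology \<Rightarrow> 'a set set \<Rightarrow> bool" where
  "compact_ideal X \<A> \<longleftrightarrow>
     (\<forall>A\<in>\<A>. compactin X A) \<and>
     (\<forall>A\<in>\<A>. \<forall>B\<in>\<A>. A \<union> B \<in> \<A>) \<and>
     (\<forall>x\<in>topspace X. {x} \<in> \<A>)"

definition PR_basic :: "'a set set \<Rightarrow> 'a set \<Rightarrow> 'a set \<Rightarrow> 'a set set" where
  "PR_basic \<A> A U = {B \<in> \<A>. A \<subseteq> B \<and> B \<subseteq> U}"

definition PR_base :: "'a topology \<Rightarrow> 'a set set \<Rightarrow> 'a set set set" where
  "PR_base X \<A> = {PR_basic \<A> A U | A U. A \<in> \<A> \<and> openin X U}"

definition PR :: "'a topology \<Rightarrow> 'a set set \<Rightarrow> 'a set topology" where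
  "PR X \<A> = topology (arbitrary union_of (\<lambda>W. W \<in> PR_base X \<A>))"

lemma openin_PR:
  assumes "compact_ideal X \<A>"
  shows "openin (PR X \<A>) = arbitrary union_of (\<lambda>W. W \<in> PR_base X \<A>)"
proof -
  have "S \<inter> T \<in> PR_base X \<A>" if ST: "S \<in> PR_base X \<A>" "T \<in> PR_base X \<A>" for S T
  proof -
    from ST obtain A U B V where S: "A \<in> \<A>" "openin X U" "S = PR_basic \<A> A U"
      and T: "B \<in> \<A>" "openin X V" "T = PR_basic \<A> B V"
      unfolding PR_base_def by blast
    have "S \<inter> T = PR_basic \<A> (A \<union> B) (U \<inter> V)"
      unfolding S T PR_basic_def by auto
    moreover have "A \<union> B \<in> \<A>" using assms S T unfolding compact_ideal_def by blast
    ultimately show ?thesis using S T openin_Int unfolding PR_base_def by blast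
  qed
  then have "istopology (arbitrary union_of (\<lambda>W. W \<in> PR_base X \<A>))"
    by (rule istopology_base)
  then show ?thesis unfolding PR_def by (rule topology_inverse')
qed

lemma topspace_PR:
  assumes "compact_ideal X \<A>"
  shows "topspace (PR X \<A>) = \<A>"
proof
  have "W \<subseteq> \<A>" if "openin (PR X \<A>) W" for W
    using that unfolding openin_PR[OF assms] union_of_def PR_base_def PR_basic_def by blast
  then show "topspace (PR X \<A>) \<subseteq> \<A>" by blast
  show "\<A> \<subseteq> topspace (PR X \<A>)"
  proof
    fix A assume A: "A \<in> \<A>"
    then have "A \<subseteq> topspace X"
      using assms compactin_subset_topspace unfolding compact_ideal_def by blast
    then have "A \<in> PR_basic \<A> A (topspace X)" using A unfolding PR_basic_def by blast
    moreover have "PR_basic \<A> A (topspace X) \<in> PR_base X \<A>"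
      using A unfolding PR_base_def by blast
    then have "openin (PR X \<A>) (PR_basic \<A> A (topspace X))"
      unfolding openin_PR[OF assms] by (simp add: arbitrary_union_of_inc)
    ultimately show "A \<in> topspace (PR X \<A>)" using openin_subset by blast
  qed
qed

section \<open>Hereditary \<open>A\<close>-Lindelof degree\<close>

definition ideal_cover :: "'a topology \<Rightarrow> 'a set set \<Rightarrow> 'a set \<Rightarrow> 'a set set \<Rightarrow> bool" where
  "ideal_cover X \<A> V \<U> \<longleftrightarrow>
     (\<forall>U\<in>\<U>. openin (subtopology X V) U) \<and> \<Union>\<U> = V \<and> V \<notin> \<U> \<and>
     (\<forall>A\<in>\<A>. A \<subseteq> V \<longrightarrow> (\<exists>U\<in>\<U>. A \<subseteq> U))"

text \<open>
  All covers of subspaces of \<open>X\<close> are sets of elements of \<open>'a set\<close>, so \<open>|UNIV :: 'a set set|\<close> bounds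
  their sizes and the cardinals on \<open>'a set\<close> suffice.
\<close>

definition ideal_Lindelof_degree :: "'a topology \<Rightarrow> 'a set set \<Rightarrow> 'a set \<Rightarrow> 'a set rel" where
  "ideal_Lindelof_degree X \<A> V =
     least_cardinal (\<lambda>\<kappa>. \<forall>\<U>. ideal_cover X \<A> V \<U> \<longrightarrow>
       (\<exists>\<W>\<subseteq>\<U>. |\<W>| \<le>o \<kappa> \<and> ideal_cover X \<A> V \<W>))"

definition hereditary_ideal_Lindelof_degree :: "'a topology \<Rightarrow> 'a set set \<Rightarrow> 'a set rel" where
  "hereditary_ideal_Lindelof_degree X \<A> =
     card_Sup {ideal_Lindelof_degree X \<A> V | V. openin X V}"

lemma ideal_Lindelof_degree:
  fixes X :: "'a topology"
  shows Card_order_ideal_Lindelof_degree: "Card_order (ideal_Lindelof_degree X \<A> V)"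
    and ideal_Lindelof_degree_subcover: "\<And>\<U>. ideal_cover X \<A> V \<U> \<Longrightarrow>
      \<exists>\<W>\<subseteq>\<U>. |\<W>| \<le>o ideal_Lindelof_degree X \<A> V \<and> ideal_cover X \<A> V \<W>"
proof -
  let ?P = "\<lambda>\<kappa>::'a set rel. \<forall>\<U>. ideal_cover X \<A> V \<U> \<longrightarrow>
       (\<exists>\<W>\<subseteq>\<U>. |\<W>| \<le>o \<kappa> \<and> ideal_cover X \<A> V \<W>)"
  have "?P |UNIV :: 'a set set|" using card_of_mono1[OF subset_UNIV] by blast
  from least_cardinal[of _ ?P, OF card_of_Card_order this]
  show "Card_order (ideal_Lindelof_degree X \<A> V)"
    "\<And>\<U>. ideal_cover X \<A> V \<U> \<Longrightarrow>
      \<exists>\<W>\<subseteq>\<U>. |\<W>| \<le>o ideal_Lindelof_degree X \<A> V \<and> ideal_cover X \<A> V \<W>"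
    unfolding ideal_Lindelof_degree_def by blast+
qed

section \<open>Discrete cellularity\<close>

definition discrete_collection :: "'b topology \<Rightarrow> 'b set set \<Rightarrow> bool" where
  "discrete_collection Y \<F> \<longleftrightarrow>
     (\<forall>F\<in>\<F>. F \<subseteq> topspace Y) \<and>
     (\<forall>y\<in>topspace Y. \<exists>W. openin Y W \<and> y \<in> W \<and>
        (\<forall>F\<in>\<F>. \<forall>G\<in>\<F>. F \<inter> W \<noteq> {} \<and> G \<inter> W \<noteq> {} \<longrightarrow> F = G))"

text \<open>No \<open>\<omega>\<close> is added to the supremum: it may be finite.\<close>

definition discrete_cellularity :: "'b topology \<Rightarrow> 'b set rel" where
  "discrete_cellularity Y =
     card_Sup {|\<F>| | \<F>. discrete_collection Y \<F> \<and> (\<forall>F\<in>\<F>. openin Y F \<and> F \<noteq> {})}"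

end

theory Submission
  imports Defs
begin

text \<open>
  Well-order an \<open>A\<close>-cover \<open>\<U>\<close> of an open set and keep those \<open>U \<in> \<U>\<close> that are the first to contain
  some \<open>A \<in> \<A>\<close>; choose such a witness \<open>A\<^sub>U\<close> for each of them. The kept sets again form an \<open>A\<close>-cover,
  and the basic open sets \<open>[A\<^sub>U, U]\<close> form a discrete family indexed by the kept sets: if \<open>U\<close> is
  the first kept set containing \<open>B\<close>, then \<open>[B, U]\<close> meets \<open>[A\<^sub>U\<^sub>', U']\<close> only if \<open>B \<subseteq> U'\<close> and
  \<open>A\<^sub>U\<^sub>' \<subseteq> U\<close>, which rules out both \<open>U' < U\<close> and \<open>U < U'\<close>.
\<close>

lemma openin_PR_basic:
  assumes "compact_ideal X \<A>" "A \<in> \<A>" "openin X U"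
  shows "openin (PR X \<A>) (PR_basic \<A> A U)"
  unfolding openin_PR[OF assms(1)]
  using assms(2,3) by (intro arbitrary_union_of_inc) (auto simp: PR_base_def)

lemma Card_order_discrete_cellularity: "Card_order (discrete_cellularity Y)"
  unfolding discrete_cellularity_def by (rule Card_order_card_Sup) (auto intro: card_of_Card_order)

lemma discrete_cellularity_upper:
  assumes "discrete_collection Y \<F>" "\<And>F. F \<in> \<F> \<Longrightarrow> openin Y F \<and> F \<noteq> {}"
  shows "|\<F>| \<le>o discrete_cellularity Y"
  unfolding discrete_cellularity_def by (rule card_Sup_upper) (use assms card_of_Card_order in auto)

text \<open>A common element C of \<open>[a U, U]\<close> and \<open>[B, N]\<close> satisfies B
  \<subseteq> C \<subseteq> U and \<open>a U\<close> \<subseteq> C \<subseteq> N. So the sets met by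
  a neighbourhood of B are controlled by inclusions alone, which the order \<open>s\<close>
  restricts to at most one index.\<close>

lemma discrete_collection_PR_basic:
  assumes ideal: "compact_ideal X \<A>"
    and s: "wf s" "total_on \<W> s"
    and W: "\<And>U. U \<in> \<W> \<Longrightarrow> openin X U"
    and first: "\<And>U U'. U \<in> \<W> \<Longrightarrow> U' \<in> \<W> \<Longrightarrow> (U', U) \<in> s \<Longrightarrow> \<not> a U \<subseteq> U'"
  shows "discrete_collection (PR X \<A>) ((\<lambda>U. PR_basic \<A> (a U) U) ` \<W>)"
  unfolding discrete_collection_def topspace_PR[OF ideal]
proof (intro conjI ballI)
  show "F \<subseteq> \<A>" if "F \<in> (\<lambda>U. PR_basic \<A> (a U) U) ` \<W>" for F
    using that by (auto simp: PR_basic_def)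
next
  fix B assume B: "B \<in> \<A>"
  then have Btop: "B \<subseteq> topspace X"
    using ideal compactin_subset_topspace unfolding compact_ideal_def by blast
  let ?F = "\<lambda>U. PR_basic \<A> (a U) U"
  \<comment> \<open>\<open>U\<close> names the only index whose basic set may be met; it is
    arbitrary when none is met.\<close>
  have "\<exists>N U. openin X N \<and> B \<subseteq> N \<and> (\<forall>U'\<in>\<W>. ?F U' \<inter> PR_basic \<A> B N \<noteq> {} \<longrightarrow> U' = U)"
  proof (cases "\<exists>U\<in>\<W>. B \<subseteq> U")
    case True
    then have "{U \<in> \<W>. B \<subseteq> U} \<noteq> {}" by blast
    then have "\<exists>U\<in>{U \<in> \<W>. B \<subseteq> U}. \<forall>U'. (U', U) \<in> s \<longrightarrow> U' \<notin> {U \<in> \<W>. B \<subseteq> U}"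
      using s(1)[unfolded wf_eq_minimal, THEN spec, of "{U \<in> \<W>. B \<subseteq> U}"] by blast
    then obtain U where U: "U \<in> \<W>" "B \<subseteq> U"
      and least: "\<And>U'. (U', U) \<in> s \<Longrightarrow> \<not> (U' \<in> \<W> \<and> B \<subseteq> U')"
      by blast
    have "U' = U" if U': "U' \<in> \<W>" and meets: "?F U' \<inter> PR_basic \<A> B U \<noteq> {}" for U'
    proof (rule ccontr)
      \<comment> \<open>The first inclusion excludes \<open>U'\<close> before \<open>U\<close> by
        minimality of \<open>U\<close>; the second excludes \<open>U\<close> before
        \<open>U'\<close> by \<open>first\<close>.\<close>
      from meets have "B \<subseteq> U'" "a U' \<subseteq> U" unfolding PR_basic_def by auto
      moreover assume "U' \<noteq> U"
      then have "(U', U) \<in> s \<or> (U, U') \<in> s"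
        using s(2) U(1) U' unfolding total_on_def by blast
      ultimately show False using least first U(1) U' by blast
    qed
    then show ?thesis using U W by blast
  next
    \<comment> \<open>The whole space serves as \<open>N\<close>: an element of \<open>?F U'\<close>
      containing B would put B inside \<open>U'\<close>.\<close>
    case False
    then have "?F U' \<inter> PR_basic \<A> B (topspace X) = {}" if "U' \<in> \<W>" for U'
      using that by (auto simp: PR_basic_def)
    then show ?thesis using Btop openin_topspace by blast
  qed
  then obtain N U where N: "openin X N" "B \<subseteq> N"
    and U: "\<And>U'. U' \<in> \<W> \<Longrightarrow> ?F U' \<inter> PR_basic \<A> B N \<noteq> {} \<Longrightarrow> U' = U"
    by blast
  show "\<exists>W. openin (PR X \<A>) W \<and> B \<in> W \<and>
      (\<forall>F\<in>?F ` \<W>. \<forall>G\<in>?F ` \<W>. F \<inter> W \<noteq> {} \<and> G \<inter> W \<noteq> {} \<longrightarrow> F = G)"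
  proof (intro exI conjI)
    show "openin (PR X \<A>) (PR_basic \<A> B N)" using ideal B N(1) by (rule openin_PR_basic)
    show "B \<in> PR_basic \<A> B N" using B N(2) by (simp add: PR_basic_def)
    show "\<forall>F\<in>?F ` \<W>. \<forall>G\<in>?F ` \<W>.
        F \<inter> PR_basic \<A> B N \<noteq> {} \<and> G \<inter> PR_basic \<A> B N \<noteq> {} \<longrightarrow> F = G"
      using U by blast
  qed
qed

text \<open>The kept sets are matched bijectively with a discrete open family, so the bound on their
  number is the same for every cover and every open V.\<close>

lemma ideal_subcover_le_discrete_cellularity:
  fixes X :: "'a topology"
  assumes ideal: "compact_ideal X \<A>" and V: "openin X V" and cover: "ideal_cover X \<A> V \<U>"
  obtains \<W> where "\<W> \<subseteq> \<U>" "ideal_cover X \<A> V \<W>" "|\<W>| \<le>o discrete_cellularity (PR X \<A>)"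
proof -
  obtain r where r: "well_order_on \<U> r" using well_order_on by blast
  \<comment> \<open>Dropping the diagonal makes the well-order well-founded as a relation and leaves
    totality intact, which concerns distinct elements only.\<close>
  define s where "s = r - Id"
  have s: "wf s" "total_on \<U> s"
    using r unfolding well_order_on_def linear_order_on_def s_def by auto
  have U_open: "openin X U" "U \<subseteq> V" if "U \<in> \<U>" for U
    using that cover V openin_open_subtopology unfolding ideal_cover_def by blast+
  define first where "first A U \<longleftrightarrow> A \<in> \<A> \<and> A \<subseteq> U \<and> (\<forall>U'\<in>\<U>. (U', U) \<in> s \<longrightarrow> \<not> A \<subseteq> U')" for A U
  define \<W> where "\<W> = {U \<in> \<U>. \<exists>A. first A U}"
  have "\<forall>U\<in>\<W>. \<exists>A. first A U" unfolding \<W>_def by blast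
  then obtain a where a: "\<And>U. U \<in> \<W> \<Longrightarrow> first (a U) U" by metis
  have sub: "\<W> \<subseteq> \<U>" unfolding \<W>_def by blast
  \<comment> \<open>The least member of \<open>\<U>\<close> containing A is kept, with A itself as
    witness.\<close>
  have refine: "\<exists>U\<in>\<W>. A \<subseteq> U" if A: "A \<in> \<A>" "A \<subseteq> V" for A
  proof -
    from A cover have "{U \<in> \<U>. A \<subseteq> U} \<noteq> {}" unfolding ideal_cover_def by blast
    then have "\<exists>U\<in>{U \<in> \<U>. A \<subseteq> U}. \<forall>U'. (U', U) \<in> s \<longrightarrow> U' \<notin> {U \<in> \<U>. A \<subseteq> U}"
      using s(1)[unfolded wf_eq_minimal, THEN spec, of "{U \<in> \<U>. A \<subseteq> U}"] by blast
    then obtain U where U: "U \<in> \<U>" "A \<subseteq> U" "\<And>U'. (U', U) \<in> s \<Longrightarrow> \<not> (U' \<in> \<U> \<and> A \<subseteq> U')"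
      by blast
    then have "first A U" using A unfolding first_def by blast
    then show ?thesis using U unfolding \<W>_def by blast
  qed
  \<comment> \<open>Singletons belong to the ideal, so refinement already forces covering.\<close>
  have "V \<subseteq> \<Union>\<W>"
  proof
    fix x assume x: "x \<in> V"
    then have "{x} \<in> \<A>" using ideal openin_subset[OF V] unfolding compact_ideal_def by blast
    then show "x \<in> \<Union>\<W>" using refine x by blast
  qed
  then have "\<Union>\<W> = V" using sub U_open by blast
  moreover have "\<forall>U\<in>\<W>. openin (subtopology X V) U" "V \<notin> \<W>"
    using cover sub unfolding ideal_cover_def by auto
  ultimately have coverW: "ideal_cover X \<A> V \<W>"
    using refine unfolding ideal_cover_def by simp
  let ?F = "\<lambda>U. PR_basic \<A> (a U) U"
  have aF: "a U \<in> ?F U" if "U \<in> \<W>" for U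
    using a[OF that] unfolding first_def PR_basic_def by blast
  \<comment> \<open>Passing to the image must not lose cardinality. If two basic sets coincided, the
    witness of the later index would lie in the earlier one.\<close>
  have "inj_on ?F \<W>"
  proof (rule inj_onI, rule ccontr)
    fix U U' assume UU': "U \<in> \<W>" "U' \<in> \<W>" "?F U = ?F U'" "U \<noteq> U'"
    then have "a U \<in> ?F U'" "a U' \<in> ?F U" using aF[of U] aF[of U'] by auto
    then have "a U \<subseteq> U'" "a U' \<subseteq> U" unfolding PR_basic_def by auto
    moreover have "(U, U') \<in> s \<or> (U', U) \<in> s"
      using UU' sub s(2) unfolding total_on_def by blast
    ultimately show False using a[OF UU'(1)] a[OF UU'(2)] UU'(1,2) sub unfolding first_def by blast
  qed
  then have "|\<W>| =o |?F ` \<W>|"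
    using card_of_ordIso bij_betw_imageI by blast
  moreover have "|?F ` \<W>| \<le>o discrete_cellularity (PR X \<A>)"
  proof (rule discrete_cellularity_upper)
    show "discrete_collection (PR X \<A>) (?F ` \<W>)"
    proof (rule discrete_collection_PR_basic[OF ideal s(1)])
      show "total_on \<W> s" using s(2) sub unfolding total_on_def by blast
      show "openin X U" if "U \<in> \<W>" for U using that sub U_open by blast
      show "\<not> a U \<subseteq> U'" if "U \<in> \<W>" "U' \<in> \<W>" "(U', U) \<in> s" for U U'
        using that a sub unfolding first_def by blast
    qed
    show "openin (PR X \<A>) F \<and> F \<noteq> {}" if F: "F \<in> ?F ` \<W>" for F
    proof -
      from F obtain U where U: "U \<in> \<W>" "F = ?F U" by blast
      have "a U \<in> \<A>" using a[OF U(1)] unfolding first_def by blast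
      then have "openin (PR X \<A>) F"
        using openin_PR_basic[OF ideal] U sub U_open by blast
      then show ?thesis using aF U by blast
    qed
  qed
  ultimately have "|\<W>| \<le>o discrete_cellularity (PR X \<A>)" by (rule ordIso_ordLeq_trans)
  with sub coverW show thesis by (rule that)
qed

text \<open>The two cardinals live on different types, so the subcover bound is transferred along
  \<open>=o\<close> to a cardinal on \<open>'a set\<close>, where the minimum is taken.\<close>

lemma ideal_Lindelof_degree_le_discrete_cellularity:
  fixes X :: "'a topology"
  assumes "compact_ideal X \<A>" "openin X V"
  shows "ideal_Lindelof_degree X \<A> V \<le>o discrete_cellularity (PR X \<A>)"
  unfolding ideal_Lindelof_degree_def
proof (rule least_cardinal_le)
  let ?P = "\<lambda>\<kappa>::'a set rel. \<forall>\<U>. ideal_cover X \<A> V \<U> \<longrightarrow>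
       (\<exists>\<W>\<subseteq>\<U>. |\<W>| \<le>o \<kappa> \<and> ideal_cover X \<A> V \<W>)"
  \<comment> \<open>Each cover is a subcover of itself, so some cardinal qualifies and the minimum
    exists.\<close>
  show "?P |UNIV|" using card_of_mono1[OF subset_UNIV] by blast
  show "?P \<kappa>" if \<kappa>: "\<kappa> =o discrete_cellularity (PR X \<A>)" for \<kappa> :: "'a set rel"
  proof (intro allI impI)
    fix \<U> assume "ideal_cover X \<A> V \<U>"
    then obtain \<W> where \<W>: "\<W> \<subseteq> \<U>" "ideal_cover X \<A> V \<W>"
      and le: "|\<W>| \<le>o discrete_cellularity (PR X \<A>)"
      by (rule ideal_subcover_le_discrete_cellularity[OF assms])
    from le ordIso_symmetric[OF \<kappa>] have "|\<W>| \<le>o \<kappa>" by (rule ordLeq_ordIso_trans)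
    with \<W> show "\<exists>\<W>\<subseteq>\<U>. |\<W>| \<le>o \<kappa> \<and> ideal_cover X \<A> V \<W>" by blast
  qed
qed (rule card_of_Card_order Card_order_discrete_cellularity)+

theorem proposition3p9:
  fixes X :: "'a topology" and \<A> :: "'a set set"
  assumes "infinite (topspace X)" and "Hausdorff_space X" and "compact_ideal X \<A>"
  shows "hereditary_ideal_Lindelof_degree X \<A> \<le>o discrete_cellularity (PR X \<A>)"
  unfolding hereditary_ideal_Lindelof_degree_def
  using ideal_Lindelof_degree_le_discrete_cellularity[OF assms(3)]
  by (intro card_Sup_le)
    (auto intro: Card_order_ideal_Lindelof_degree Card_order_discrete_cellularity)

end
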